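(* Let $G$ be a connected simple graph on $n$ vertices and let $\Phi=\{\phi_i\}_{i\in[n]}$ be an $L_G(n,n-1)$-frame for $\mathbb{C}^{n-1}$ with frame operator $S_\Phi$. Then $\rho^{(r)}_{\Phi,S_\Phi^{-1}\Phi}=1$ for every $r\in[n-1]\setminus\{1\}$.
   Context: $[n]=\{1,\dots,n\}$. A finite sequence $\Phi=\{\phi_i\}_{i\in[n]}$ in $\mathbb{C}^m$ is a frame for $\mathbb{C}^m$ if there are constants $0<A\le B$ with $A\|f\|^2\le\sum_{i\in[n]}|\langle f,\phi_i\rangle|^2\le B\|f\|^2$ for all $f\in\mathbb{C}^m$ (inner product linear in the first argument). Its frame operator is $S_\Phi f=\sum_{i\in[n]}\langle f,\phi_i\rangle\phi_i$, which is invertible. A frame $\Psi=\{\psi_i\}_{i\in[n]}$ for $\mathbb{C}^m$ is a dual frame of $\Phi$ if $f=\sum_{i\in[n]}\langle f,\phi_i\rangle\psi_i=\sum_{i\in[n]}\langle f,\psi_i\rangle\phi_i$ for all $f\in\mathbb{C}^m$; the canonical dual frame is $S_\Phi^{-1}\Phi=\{S_\Phi^{-1}\phi_i\}_{i\in[n]}$. For a frame $\Phi$, a dual frame $\Psi$ of $\Phi$ and $\Lambda\subset[n]$, the error operator is $E_{\Phi,\Psi,\Lambda}:\mathbb{C}^m\to\mathbb{C}^m$, $E_{\Phi,\Psi,\Lambda}(f)=\sum_{i\in\Lambda}\langle f,\phi_i\rangle\psi_i$. For $1\le r<n$, $\rho^{(r)}_{\Phi,\Psi}=\max\{\rho(E_{\Phi,\Psi,\Lambda}):\Lambda\subset[n],\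 |\Lambda|=r\}$, where $\rho(\cdot)$ denotes the spectral radius. For a simple graph $G$ with vertices $v_1,\dots,v_n$, the Laplacian matrix is $L=D-A$, with $D$ the diagonal matrix of vertex degrees and $A$ the adjacency matrix. It is positive semidefinite, and if $G$ has $n-m$ connected components then $L$ has rank $m$. $L_G(n,m)$-frame: let $G$ be a simple graph on $n$ vertices with $n-m$ connected components, and write $L=M\,\mathrm{diag}(\lambda_1,\dots,\lambda_m,0,\dots,0)\,M^*$ with $M$ an $n\times n$ unitary matrix and $\lambda_1,\dots,\lambda_m$ the nonzero eigenvalues of $L$ (with multiplicity). Let $M_1$ be the submatrix of $M$ formed by its first $m$ columns, $B=\mathrm{diag}(\sqrt{\lambda_1},\dots,\sqrt{\lambda_m})M_1^*$, and $\{e_i\}_{i\in[n]}$ the standard basis of $\mathbb{C}^n$. Then $\{Be_i\}_{i\in[n]}$ is a frame for $\mathbb{C}^m$; any frame arising in this way is called an $L_G(n,m)$-frame for $\mathbb{C}^m$. *)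

theory Defs
  imports "Jordan_Normal_Form.Spectral_Radius" "Jordan_Normal_Form.Schur_Decomposition"
    "Graph_Theory.Graph_Theory"
begin

text \<open>
  Vectors of \<open>\<complex>\<^sup>m\<close> are the elements of \<open>carrier_vec m\<close>, and a finite sequence
  of vectors indexed by \<open>[n]\<close> is a function on \<open>nat\<close> of which only the values on
  \<open>{..<n}\<close> matter; following the matrix library, indices start at 0.
  The product \<open>v \<bullet>c w\<close> is linear in \<open>v\<close> and conjugate-linear in \<open>w\<close>.
\<close>

section \<open>Frames\<close>

definition is_frame :: "nat \<Rightarrow> nat \<Rightarrow> (nat \<Rightarrow> complex vec) \<Rightarrow> bool" where
  "is_frame n m \<Phi> \<longleftrightarrow> (\<forall>i<n. \<Phi> i \<in> carrier_vec m) \<and>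
     (\<exists>A B. 0 < A \<and> A \<le> B \<and> (\<forall>f \<in> carrier_vec m.
        A * (\<Sum>k<m. (cmod (f $ k))\<^sup>2) \<le> (\<Sum>i<n. (cmod (f \<bullet>c \<Phi> i))\<^sup>2) \<and>
        (\<Sum>i<n. (cmod (f \<bullet>c \<Phi> i))\<^sup>2) \<le> B * (\<Sum>k<m. (cmod (f $ k))\<^sup>2)))"

definition frame_op :: "nat \<Rightarrow> nat \<Rightarrow> (nat \<Rightarrow> complex vec) \<Rightarrow> complex vec \<Rightarrow> complex vec" where
  "frame_op n m \<Phi> f = finsum_vec TYPE(complex) m (\<lambda>i. (f \<bullet>c \<Phi> i) \<cdot>\<^sub>v \<Phi> i) {..<n}"

text \<open>The inverse is meaningful because the frame operator of a frame is a bijection of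
  \<open>carrier_vec m\<close>, see \<open>bij_betw_frame_op\<close>; by \<open>is_LG_frame_imp_is_frame\<close>
  this applies to the frames of a graph.\<close>

definition canonical_dual :: "nat \<Rightarrow> nat \<Rightarrow> (nat \<Rightarrow> complex vec) \<Rightarrow> nat \<Rightarrow> complex vec" where
  "canonical_dual n m \<Phi> i = inv_into (carrier_vec m) (frame_op n m \<Phi>) (\<Phi> i)"

definition error_op ::
  "nat \<Rightarrow> (nat \<Rightarrow> complex vec) \<Rightarrow> (nat \<Rightarrow> complex vec) \<Rightarrow> nat set \<Rightarrow> complex vec \<Rightarrow> complex vec" where
  "error_op m \<Phi> \<Psi> \<Lambda> f = finsum_vec TYPE(complex) m (\<lambda>i. (f \<bullet>c \<Phi> i) \<cdot>\<^sub>v \<Psi> i) \<Lambda>"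

text \<open>The library defines the spectral radius for matrices; it is applied to the
  matrix of an operator with respect to the standard basis.\<close>

definition operator_mat :: "nat \<Rightarrow> (complex vec \<Rightarrow> complex vec) \<Rightarrow> complex mat" where
  "operator_mat m T = mat m m (\<lambda>(i, j). T (unit_vec m j) $ i)"

definition max_error_radius ::
  "nat \<Rightarrow> nat \<Rightarrow> (nat \<Rightarrow> complex vec) \<Rightarrow> (nat \<Rightarrow> complex vec) \<Rightarrow> nat \<Rightarrow> real" where
  "max_error_radius n m \<Phi> \<Psi> r =
     Max {spectral_radius (operator_mat m (error_op m \<Phi> \<Psi> \<Lambda>)) | \<Lambda>. \<Lambda> \<subseteq> {..<n} \<and> card \<Lambda> = r}"


lemma cscalar_prod_sum:
  assumes "w \<in> carrier_vec m"
  shows "(f :: complex vec) \<bullet>c w = (\<Sum>k<m. f $ k * cnj (w $ k))"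
  using assms by (auto simp: scalar_prod_def lessThan_atLeast0 intro!: sum.cong)

lemma frame_op_carrier:
  assumes "\<forall>i<n. \<Phi> i \<in> carrier_vec m"
  shows "frame_op n m \<Phi> f \<in> carrier_vec m"
  unfolding frame_op_def using assms by (intro finsum_vec_closed) auto

lemma index_frame_op:
  assumes "\<forall>i<n. \<Phi> i \<in> carrier_vec m" "k < m"
  shows "frame_op n m \<Phi> f $ k = (\<Sum>i<n. (f \<bullet>c \<Phi> i) * \<Phi> i $ k)"
proof -
  have "frame_op n m \<Phi> f $ k = (\<Sum>i<n. ((f \<bullet>c \<Phi> i) \<cdot>\<^sub>v \<Phi> i) $ k)"
    unfolding frame_op_def using assms by (subst index_finsum_vec) auto
  also have "\<dots> = (\<Sum>i<n. (f \<bullet>c \<Phi> i) * \<Phi> i $ k)"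
    using assms by (intro sum.cong) auto
  finally show ?thesis .
qed

lemma bij_betw_frame_op:
  assumes "is_frame n m \<Phi>"
  shows "bij_betw (frame_op n m \<Phi>) (carrier_vec m) (carrier_vec m)"
proof -
  from assms obtain A where car: "\<forall>i<n. \<Phi> i \<in> carrier_vec m" and A: "0 < A"
    and lower: "\<And>f. f \<in> carrier_vec m \<Longrightarrow>
      A * (\<Sum>k<m. (cmod (f $ k))\<^sup>2) \<le> (\<Sum>i<n. (cmod (f \<bullet>c \<Phi> i))\<^sup>2)"
    unfolding is_frame_def by blast
  define T where "T = mat m m (\<lambda>(k, j). \<Sum>i<n. cnj (\<Phi> i $ j) * \<Phi> i $ k)"
  have T: "T \<in> carrier_mat m m"
    by (simp add: T_def)
  have eq: "frame_op n m \<Phi> f = T *\<^sub>v f" if f: "f \<in> carrier_vec m" for f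
  proof (rule eq_vecI)
    show "dim_vec (frame_op n m \<Phi> f) = dim_vec (T *\<^sub>v f)"
      using frame_op_carrier[OF car, of f] T by auto
    fix k assume "k < dim_vec (T *\<^sub>v f)"
    then have k: "k < m"
      using T by auto
    have "frame_op n m \<Phi> f $ k = (\<Sum>i<n. \<Sum>j<m. f $ j * cnj (\<Phi> i $ j) * \<Phi> i $ k)"
      unfolding index_frame_op[OF car k] using car
      by (intro sum.cong) (simp_all add: cscalar_prod_sum[of _ m] sum_distrib_right)
    also have "\<dots> = (\<Sum>j<m. (\<Sum>i<n. cnj (\<Phi> i $ j) * \<Phi> i $ k) * f $ j)"
      by (subst sum.swap) (simp add: sum_distrib_left mult_ac)
    also have "\<dots> = (T *\<^sub>v f) $ k"
      using k f by (auto simp: T_def scalar_prod_def lessThan_atLeast0 intro!: sum.cong)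
    finally show "frame_op n m \<Phi> f $ k = (T *\<^sub>v f) $ k" .
  qed
  have inj0: "f = 0\<^sub>v m" if f: "f \<in> carrier_vec m" and z: "T *\<^sub>v f = 0\<^sub>v m" for f
  proof -
    have S0: "(\<Sum>i<n. (f \<bullet>c \<Phi> i) * \<Phi> i $ k) = 0" if "k < m" for k
      using index_frame_op[OF car that, of f] eq[OF f] z that by simp
    have "complex_of_real (\<Sum>i<n. (cmod (f \<bullet>c \<Phi> i))\<^sup>2) = (\<Sum>i<n. (f \<bullet>c \<Phi> i) * cnj (f \<bullet>c \<Phi> i))"
      by (simp only: of_real_sum complex_norm_square)
    also have "\<dots> = (\<Sum>i<n. \<Sum>k<m. (f \<bullet>c \<Phi> i) * \<Phi> i $ k * cnj (f $ k))"
      using car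
      by (intro sum.cong) (simp_all add: cscalar_prod_sum[of _ m] sum_distrib_left mult_ac)
    also have "\<dots> = (\<Sum>k<m. (\<Sum>i<n. (f \<bullet>c \<Phi> i) * \<Phi> i $ k) * cnj (f $ k))"
      by (subst sum.swap) (simp add: sum_distrib_right)
    also have "\<dots> = 0"
      using S0 by simp
    finally have "(\<Sum>i<n. (cmod (f \<bullet>c \<Phi> i))\<^sup>2) = 0"
      by (simp only: of_real_eq_0_iff)
    with lower[OF f] A have "(\<Sum>k<m. (cmod (f $ k))\<^sup>2) \<le> 0"
      by (simp add: mult_le_0_iff)
    then have "(\<Sum>k<m. (cmod (f $ k))\<^sup>2) = 0"
      by (rule antisym) (simp add: sum_nonneg)
    then have "\<forall>k<m. f $ k = 0"
      by (subst (asm) sum_nonneg_eq_0_iff) auto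
    then show ?thesis
      using f by (intro eq_vecI) auto
  qed
  have "det T \<noteq> 0"
    using det_0_iff_vec_prod_zero[OF T] inj0 by blast
  then obtain R where R: "R \<in> carrier_mat m m" "T * R = 1\<^sub>m m" "R * T = 1\<^sub>m m"
    using det_non_zero_imp_unit[OF T, of "()"] by (auto simp: Units_def ring_mat_def)
  show ?thesis
  proof (rule bij_betw_byWitness[where f' = "\<lambda>g. R *\<^sub>v g"])
    show "\<forall>f\<in>carrier_vec m. R *\<^sub>v frame_op n m \<Phi> f = f"
      using R T eq by (metis assoc_mult_mat_vec one_mult_mat_vec)
    show "\<forall>f\<in>carrier_vec m. frame_op n m \<Phi> (R *\<^sub>v f) = f"
      using R T eq by (metis assoc_mult_mat_vec mult_mat_vec_carrier one_mult_mat_vec)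
    show "frame_op n m \<Phi> ` carrier_vec m \<subseteq> carrier_vec m"
      using frame_op_carrier[OF car] by blast
    show "(\<lambda>g. R *\<^sub>v g) ` carrier_vec m \<subseteq> carrier_vec m"
      using R by auto
  qed
qed


section \<open>Graph Laplacians and the frames they generate\<close>

text \<open>
  A simple graph is a symmetric loop-free digraph without parallel arcs (locale
  \<open>graph\<close>), so every edge is a pair of opposite arcs, the degree of a vertex is
  its out-degree, and the connected components are the strongly connected ones.
  The distinct list \<open>vs\<close> enumerates the vertices.
\<close>

definition degree_mat :: "('a, 'b) pre_digraph \<Rightarrow> 'a list \<Rightarrow> complex mat" where
  "degree_mat G vs = mat_diag (length vs) (\<lambda>i. of_nat (out_degree G (vs ! i)))"

definition adjacency_mat :: "('a, 'b) pre_digraph \<Rightarrow> 'a list \<Rightarrow> complex mat" where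
  "adjacency_mat G vs = mat (length vs) (length vs)
     (\<lambda>(i, j). if (vs ! i) \<rightarrow>\<^bsub>G\<^esub> (vs ! j) then 1 else 0)"

definition laplacian_mat :: "('a, 'b) pre_digraph \<Rightarrow> 'a list \<Rightarrow> complex mat" where
  "laplacian_mat G vs = degree_mat G vs - adjacency_mat G vs"

definition unitary_mat :: "nat \<Rightarrow> complex mat \<Rightarrow> bool" where
  "unitary_mat n M \<longleftrightarrow> M \<in> carrier_mat n n \<and>
     M * mat_adjoint M = 1\<^sub>m n \<and> mat_adjoint M * M = 1\<^sub>m n"

definition first_cols :: "nat \<Rightarrow> nat \<Rightarrow> complex mat \<Rightarrow> complex mat" where
  "first_cols n m M = mat n m (\<lambda>(i, j). M $$ (i, j))"

text \<open>
  The numbers \<open>l 0, \<dots>, l (m - 1)\<close> are automatically the nonzero eigenvalues of the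
  Laplacian with multiplicity, hence positive, because the Laplacian is unitarily
  similar to the diagonal matrix they define.
\<close>

definition is_LG_frame ::
  "('a, 'b) pre_digraph \<Rightarrow> nat \<Rightarrow> nat \<Rightarrow> (nat \<Rightarrow> complex vec) \<Rightarrow> bool" where
  "is_LG_frame G n m \<Phi> \<longleftrightarrow>
     graph G \<and> card (verts G) = n \<and> card (pre_digraph.sccs_verts G) + m = n \<and>
     (\<exists>vs M (l :: nat \<Rightarrow> real).
        distinct vs \<and> set vs = verts G \<and> unitary_mat n M \<and> (\<forall>i<m. l i \<noteq> 0) \<and>
        laplacian_mat G vs =
          M * mat_diag n (\<lambda>i. if i < m then of_real (l i) else 0) * mat_adjoint M \<and>
        (\<forall>i<n. \<Phi> i =
          (mat_diag m (\<lambda>k. of_real (sqrt (l k))) * mat_adjoint (first_cols n m M)) *\<^sub>v unit_vec n i))"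

lemma is_LG_frame_imp_is_frame:
  assumes "is_LG_frame G n m \<Phi>"
  shows "is_frame n m \<Phi>"
proof -
  from assms obtain M and l :: "nat \<Rightarrow> real" where mn: "m \<le> n" and M: "unitary_mat n M"
    and l: "\<And>i. i < m \<Longrightarrow> l i \<noteq> 0"
    and \<Phi>: "\<And>i. i < n \<Longrightarrow> \<Phi> i =
      (mat_diag m (\<lambda>k. of_real (sqrt (l k))) * mat_adjoint (first_cols n m M)) *\<^sub>v unit_vec n i"
    unfolding is_LG_frame_def by force
  have Mc: "M \<in> carrier_mat n n" and MM: "mat_adjoint M * M = 1\<^sub>m n"
    using M by (auto simp: unitary_mat_def)
  have adj: "mat_adjoint (first_cols n m M) = mat m n (\<lambda>(k, i). cnj (M $$ (i, k)))"
    by (rule eq_matI) (auto simp: mat_adjoint_def first_cols_def mat_of_rows_def)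
  have \<Phi>': "\<Phi> i = vec m (\<lambda>k. of_real (sqrt (l k)) * cnj (M $$ (i, k)))" if "i < n" for i
    unfolding \<Phi>[OF that] adj using that by (subst mat_diag_mult_left[where nr = n]) auto
  have orth: "(\<Sum>i<n. M $$ (i, k) * cnj (M $$ (i, j))) = (if j = k then 1 else 0)"
    if "k < m" "j < m" for k j
  proof -
    have "(mat_adjoint M * M) $$ (j, k) = (\<Sum>i<n. M $$ (i, k) * cnj (M $$ (i, j)))"
      using that mn Mc
      by (auto simp: mat_adjoint_def mat_of_rows_def scalar_prod_def lessThan_atLeast0
          mult.commute intro!: sum.cong)
    then show ?thesis
      using that mn by (simp add: MM)
  qed
  have eq: "(\<Sum>i<n. (cmod (f \<bullet>c \<Phi> i))\<^sup>2) = (\<Sum>k<m. \<bar>l k\<bar> * (cmod (f $ k))\<^sup>2)" for f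
  proof -
    let ?a = "\<lambda>k. f $ k * of_real (sqrt (l k))"
    have ip: "f \<bullet>c \<Phi> i = (\<Sum>k<m. ?a k * M $$ (i, k))" if "i < n" for i
      using \<Phi>'[OF that] by (simp add: cscalar_prod_sum[of _ m] mult_ac)
    have "complex_of_real (\<Sum>i<n. (cmod (f \<bullet>c \<Phi> i))\<^sup>2) = (\<Sum>i<n. (f \<bullet>c \<Phi> i) * cnj (f \<bullet>c \<Phi> i))"
      by (simp only: of_real_sum complex_norm_square)
    also have "\<dots> = (\<Sum>i<n. \<Sum>k<m. \<Sum>j<m. ?a k * cnj (?a j) * (M $$ (i, k) * cnj (M $$ (i, j))))"
      by (intro sum.cong) (simp_all add: ip sum_product mult_ac)
    also have "\<dots> = (\<Sum>k<m. \<Sum>j<m. \<Sum>i<n. ?a k * cnj (?a j) * (M $$ (i, k) * cnj (M $$ (i, j))))"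
      by (subst sum.swap, rule sum.cong[OF refl], rule sum.swap)
    also have "\<dots> = (\<Sum>k<m. \<Sum>j<m. ?a k * cnj (?a j) * (if j = k then 1 else 0))"
      by (intro sum.cong refl, subst sum_distrib_left[symmetric], subst orth) auto
    also have "\<dots> = (\<Sum>k<m. ?a k * cnj (?a k))"
      by (intro sum.cong refl) (simp add: if_distrib[of "\<lambda>x. _ * x"] cong: if_cong)
    also have "\<dots> = (\<Sum>k<m. of_real ((cmod (?a k))\<^sup>2))"
      by (simp only: complex_norm_square)
    also have "\<dots> = of_real (\<Sum>k<m. \<bar>l k\<bar> * (cmod (f $ k))\<^sup>2)"
    proof -
      have "(cmod (?a k))\<^sup>2 = \<bar>l k\<bar> * (cmod (f $ k))\<^sup>2" for k
        by (simp add: norm_mult power_mult_distrib flip: real_sqrt_abs)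
          (simp add: power2_eq_square real_sqrt_mult_self mult.commute)
      then show ?thesis
        by (simp only: of_real_sum)
    qed
    finally show ?thesis
      by (simp only: of_real_eq_iff)
  qed
  define I where "I = insert 1 ((\<lambda>k. \<bar>l k\<bar>) ` {..<m})"
  have I: "finite I" "I \<noteq> {}" and mem: "\<And>k. k < m \<Longrightarrow> \<bar>l k\<bar> \<in> I"
    by (auto simp: I_def)
  show ?thesis
    unfolding is_frame_def
  proof (intro conjI exI ballI allI impI)
    show "\<Phi> i \<in> carrier_vec m" if "i < n" for i
      using \<Phi>'[OF that] by simp
    show "0 < Min I"
      using l I by (auto simp: I_def)
    show "Min I \<le> Max I"
      using I by simp
    show "Min I * (\<Sum>k<m. (cmod (f $ k))\<^sup>2) \<le> (\<Sum>i<n. (cmod (f \<bullet>c \<Phi> i))\<^sup>2)" for f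
      unfolding eq sum_distrib_left using I mem by (intro sum_mono mult_right_mono) auto
    show "(\<Sum>i<n. (cmod (f \<bullet>c \<Phi> i))\<^sup>2) \<le> Max I * (\<Sum>k<m. (cmod (f $ k))\<^sup>2)" for f
      unfolding eq sum_distrib_left using I mem by (intro sum_mono mult_right_mono) auto
  qed
qed

end

theory Submission
  imports Defs
begin

text \<open>
  For the canonical dual of any frame, \<open>\<langle>E f, S f\<rangle>\<close> is the sum of \<open>\<bar>\<langle>f, \<phi>\<^sub>i\<rangle>\<bar>\<^sup>2\<close> over \<open>\<Lambda>\<close>
  and \<open>\<langle>f, S f\<rangle>\<close> the sum over all indices, so every eigenvalue of \<open>E\<close> has modulus at most 1.
  For a frame of a graph with Laplacian of rank \<open>n - 1\<close>, the linear relations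
  among the \<open>\<phi>\<^sub>i\<close> are exactly the multiples of \<open>\<Sum>\<^sub>i \<phi>\<^sub>i = 0\<close>. Expanding \<open>\<phi>\<^sub>i - \<phi>\<^sub>j\<close> in the frame
  therefore shows that \<open>f = \<psi>\<^sub>i - \<psi>\<^sub>j\<close> has coefficients \<open>\<langle>f, \<phi>\<^sub>p\<rangle> = \<delta>\<^sub>p\<^sub>i - \<delta>\<^sub>p\<^sub>j\<close>; if \<open>i, j \<in> \<Lambda>\<close>,
  this gives \<open>E f = f\<close>, and the bound is attained as soon as \<open>\<Lambda>\<close> has two elements.
\<close>

section \<open>Error operators: coordinates, inner products and matrices\<close>

lemma index_error_op:
  assumes "finite \<Lambda>" "\<And>i. i \<in> \<Lambda> \<Longrightarrow> \<Psi> i \<in> carrier_vec m" "k < m"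
  shows "error_op m \<Phi> \<Psi> \<Lambda> f $ k = (\<Sum>i\<in>\<Lambda>. (f \<bullet>c \<Phi> i) * \<Psi> i $ k)"
proof -
  have "error_op m \<Phi> \<Psi> \<Lambda> f $ k = (\<Sum>i\<in>\<Lambda>. ((f \<bullet>c \<Phi> i) \<cdot>\<^sub>v \<Psi> i) $ k)"
    unfolding error_op_def using assms by (subst index_finsum_vec) auto
  also have "\<dots> = (\<Sum>i\<in>\<Lambda>. (f \<bullet>c \<Phi> i) * \<Psi> i $ k)"
  proof (rule sum.cong)
    fix i assume "i \<in> \<Lambda>"
    then have "\<Psi> i \<in> carrier_vec m" by (rule assms)
    then show "((f \<bullet>c \<Phi> i) \<cdot>\<^sub>v \<Psi> i) $ k = (f \<bullet>c \<Phi> i) * \<Psi> i $ k"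
      using \<open>k < m\<close> by simp
  qed simp
  finally show ?thesis .
qed

lemma error_op_carrier:
  assumes "\<And>i. i \<in> \<Lambda> \<Longrightarrow> \<Psi> i \<in> carrier_vec m"
  shows "error_op m \<Phi> \<Psi> \<Lambda> f \<in> carrier_vec m"
  unfolding error_op_def using assms by (intro finsum_vec_closed) auto

text \<open>Lets the formulas for error operators be reused for the frame operator, with \<Psi> =
  \<Phi> and the full index set.\<close>

lemma frame_op_eq_error_op: "frame_op n m \<Phi> = error_op m \<Phi> \<Phi> {..<n}"
  by (simp add: fun_eq_iff frame_op_def error_op_def)

lemma cscalar_prod_commute:
  fixes f g :: "complex vec"
  assumes "f \<in> carrier_vec m" "g \<in> carrier_vec m"
  shows "g \<bullet>c f = cnj (f \<bullet>c g)"
  using assms by (simp add: cscalar_prod_sum[of _ m] mult.commute)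

lemma error_op_cscalar_prod:
  assumes "finite \<Lambda>" "\<And>i. i \<in> \<Lambda> \<Longrightarrow> \<Psi> i \<in> carrier_vec m" "g \<in> carrier_vec m"
  shows "error_op m \<Phi> \<Psi> \<Lambda> f \<bullet>c g = (\<Sum>i\<in>\<Lambda>. (f \<bullet>c \<Phi> i) * (\<Psi> i \<bullet>c g))"
proof -
  have "error_op m \<Phi> \<Psi> \<Lambda> f \<bullet>c g = (\<Sum>k<m. \<Sum>i\<in>\<Lambda>. (f \<bullet>c \<Phi> i) * \<Psi> i $ k * cnj (g $ k))"
    using assms by (simp add: cscalar_prod_sum[of g m] index_error_op sum_distrib_right)
  also have "\<dots> = (\<Sum>i\<in>\<Lambda>. (f \<bullet>c \<Phi> i) * (\<Psi> i \<bullet>c g))"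
    by (subst sum.swap)
      (simp add: cscalar_prod_sum[OF assms(3)] sum_distrib_left mult_ac)
  finally show ?thesis .
qed

text \<open>The spectral radius is defined for matrices, so eigenvectors of
  \<open>operator_mat\<close> have to be read as eigenvectors of the operator itself. Linearity in
  the first argument of the inner product makes this possible.\<close>

lemma operator_mat_error_op_mult_vec:
  assumes "finite \<Lambda>" "\<And>i. i \<in> \<Lambda> \<Longrightarrow> \<Phi> i \<in> carrier_vec m"
    and \<Psi>: "\<And>i. i \<in> \<Lambda> \<Longrightarrow> \<Psi> i \<in> carrier_vec m" and f: "f \<in> carrier_vec m"
  shows "operator_mat m (error_op m \<Phi> \<Psi> \<Lambda>) *\<^sub>v f = error_op m \<Phi> \<Psi> \<Lambda> f"
proof (rule eq_vecI)
  show "dim_vec (operator_mat m (error_op m \<Phi> \<Psi> \<Lambda>) *\<^sub>v f) = dim_vec (error_op m \<Phi> \<Psi> \<Lambda> f)"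
    using carrier_vecD[OF error_op_carrier[of \<Lambda> \<Psi> m \<Phi> f, OF \<Psi>]] by (simp add: operator_mat_def)
  fix k assume "k < dim_vec (error_op m \<Phi> \<Psi> \<Lambda> f)"
  then have k: "k < m"
    using carrier_vecD[OF error_op_carrier[of \<Lambda> \<Psi> m \<Phi> f, OF \<Psi>]] by simp
  \<comment> \<open>Column \<open>j\<close> of the matrix is the image of
    \<open>unit_vec m j\<close>, whose coefficient against \<Phi> i is
    \<open>cnj (\<Phi> i $ j)\<close>.\<close>
  have "(operator_mat m (error_op m \<Phi> \<Psi> \<Lambda>) *\<^sub>v f) $ k
      = (\<Sum>j<m. \<Sum>i\<in>\<Lambda>. cnj (\<Phi> i $ j) * \<Psi> i $ k * f $ j)"
  proof -
    have "(operator_mat m (error_op m \<Phi> \<Psi> \<Lambda>) *\<^sub>v f) $ k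
        = (\<Sum>j<m. error_op m \<Phi> \<Psi> \<Lambda> (unit_vec m j) $ k * f $ j)"
      using k f by (auto simp: operator_mat_def scalar_prod_def lessThan_atLeast0 intro!: sum.cong)
    then show ?thesis
      using k assms
      by (auto simp: index_error_op sum_distrib_right carrier_vecD[OF assms(2)] intro!: sum.cong)
  qed
  also have "\<dots> = (\<Sum>i\<in>\<Lambda>. (f \<bullet>c \<Phi> i) * \<Psi> i $ k)"
    using assms by (subst sum.swap)
      (auto simp: cscalar_prod_sum[of _ m] sum_distrib_left sum_distrib_right mult_ac intro!: sum.cong)
  also have "\<dots> = error_op m \<Phi> \<Psi> \<Lambda> f $ k"
    using assms k by (simp add: index_error_op)
  finally show "(operator_mat m (error_op m \<Phi> \<Psi> \<Lambda>) *\<^sub>v f) $ k = error_op m \<Phi> \<Psi> \<Lambda> f $ k" .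
qed

section \<open>The canonical dual and the bound on eigenvalues\<close>

lemma
  assumes "is_frame n m \<Phi>" "i < n"
  shows canonical_dual_carrier: "canonical_dual n m \<Phi> i \<in> carrier_vec m"
    and frame_op_canonical_dual: "frame_op n m \<Phi> (canonical_dual n m \<Phi> i) = \<Phi> i"
proof -
  have "\<Phi> i \<in> frame_op n m \<Phi> ` carrier_vec m"
    using bij_betw_frame_op[OF assms(1)] assms by (auto simp: bij_betw_def is_frame_def)
  then show "canonical_dual n m \<Phi> i \<in> carrier_vec m"
    "frame_op n m \<Phi> (canonical_dual n m \<Phi> i) = \<Phi> i"
    unfolding canonical_dual_def by (rule inv_into_into, rule f_inv_into_f)
qed

text \<open>Both sides expand to the sum of
  \<open>(f \<bullet>c \<Phi> i) * (\<Phi> i \<bullet>c g)\<close>; the left one does so after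
  conjugation.\<close>

lemma frame_op_self_adjoint:
  assumes "is_frame n m \<Phi>" "f \<in> carrier_vec m" "g \<in> carrier_vec m"
  shows "f \<bullet>c frame_op n m \<Phi> g = frame_op n m \<Phi> f \<bullet>c g"
proof -
  have car: "\<And>i. i < n \<Longrightarrow> \<Phi> i \<in> carrier_vec m"
    using assms(1) by (auto simp: is_frame_def)
  have inner: "frame_op n m \<Phi> f \<bullet>c g = (\<Sum>i<n. (f \<bullet>c \<Phi> i) * (\<Phi> i \<bullet>c g))"
    if "g \<in> carrier_vec m" for f g
    unfolding frame_op_eq_error_op by (rule error_op_cscalar_prod) (use that car in auto)
  have "f \<bullet>c frame_op n m \<Phi> g = cnj (\<Sum>i<n. (g \<bullet>c \<Phi> i) * (\<Phi> i \<bullet>c f))"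
    using cscalar_prod_commute[of "frame_op n m \<Phi> g" m f] frame_op_carrier[of n \<Phi> m g]
      inner[OF assms(2), of g] car assms(2) by simp
  also have "\<dots> = (\<Sum>i<n. (f \<bullet>c \<Phi> i) * (\<Phi> i \<bullet>c g))"
    using assms car by (auto simp: cscalar_prod_commute[of f m] cscalar_prod_commute[of _ m g] intro!: sum.cong)
  also have "\<dots> = frame_op n m \<Phi> f \<bullet>c g"
    using inner[OF assms(3)] by simp
  finally show ?thesis .
qed

text \<open>Self-adjointness moves S onto the dual vector, and S sends it back to \<Phi> i. Pairing
  with S f instead of f thus turns each term into a squared modulus.\<close>

lemma error_op_canonical_dual_cscalar_prod_frame_op:
  assumes fr: "is_frame n m \<Phi>" and L: "\<Lambda> \<subseteq> {..<n}" and f: "f \<in> carrier_vec m"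
  shows "error_op m \<Phi> (canonical_dual n m \<Phi>) \<Lambda> f \<bullet>c frame_op n m \<Phi> f
    = of_real (\<Sum>i\<in>\<Lambda>. (cmod (f \<bullet>c \<Phi> i))\<^sup>2)"
proof -
  have fin: "finite \<Lambda>"
    using L finite_subset by blast
  have car: "\<And>i. i < n \<Longrightarrow> \<Phi> i \<in> carrier_vec m"
    using fr by (auto simp: is_frame_def)
  have dual: "\<And>i. i \<in> \<Lambda> \<Longrightarrow> canonical_dual n m \<Phi> i \<in> carrier_vec m"
    using L by (intro canonical_dual_carrier[OF fr]) auto
  have "error_op m \<Phi> (canonical_dual n m \<Phi>) \<Lambda> f \<bullet>c frame_op n m \<Phi> f
      = (\<Sum>i\<in>\<Lambda>. (f \<bullet>c \<Phi> i) * (canonical_dual n m \<Phi> i \<bullet>c frame_op n m \<Phi> f))"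
    using fin dual car by (intro error_op_cscalar_prod frame_op_carrier) auto
  also have "\<dots> = (\<Sum>i\<in>\<Lambda>. (f \<bullet>c \<Phi> i) * cnj (f \<bullet>c \<Phi> i))"
  proof (rule sum.cong)
    fix i assume "i \<in> \<Lambda>"
    with L have i: "i < n" by auto
    have "canonical_dual n m \<Phi> i \<bullet>c frame_op n m \<Phi> f = cnj (f \<bullet>c \<Phi> i)"
      using frame_op_self_adjoint[OF fr canonical_dual_carrier[OF fr i] f]
        frame_op_canonical_dual[OF fr i] cscalar_prod_commute[OF f car[OF i]] by simp
    then show "(f \<bullet>c \<Phi> i) * (canonical_dual n m \<Phi> i \<bullet>c frame_op n m \<Phi> f)
        = (f \<bullet>c \<Phi> i) * cnj (f \<bullet>c \<Phi> i)" by simp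
  qed simp
  also have "\<dots> = of_real (\<Sum>i\<in>\<Lambda>. (cmod (f \<bullet>c \<Phi> i))\<^sup>2)"
    by (simp only: of_real_sum complex_norm_square)
  finally show ?thesis .
qed

lemma frame_coefficients_pos:
  assumes "is_frame n m \<Phi>" "f \<in> carrier_vec m" "f \<noteq> 0\<^sub>v m"
  shows "0 < (\<Sum>i<n. (cmod (f \<bullet>c \<Phi> i))\<^sup>2)"
proof -
  obtain A where A: "0 < A" "A * (\<Sum>k<m. (cmod (f $ k))\<^sup>2) \<le> (\<Sum>i<n. (cmod (f \<bullet>c \<Phi> i))\<^sup>2)"
    using assms unfolding is_frame_def by blast
  obtain k where "k < m" "f $ k \<noteq> 0"
    using assms by (metis carrier_vecD eq_vecI index_zero_vec(1) zero_carrier_vec)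
  then have "0 < (\<Sum>k<m. (cmod (f $ k))\<^sup>2)"
    by (intro sum_pos2[of _ k]) auto
  with A show ?thesis
    by (meson less_le_trans mult_pos_pos)
qed

text \<open>Pairing the eigenvalue equation with S f exhibits \<mu> as the ratio of a partial sum of
  squared coefficients to the full sum, which is positive by the lower frame bound.\<close>

lemma eigenvalue_error_op_canonical_dual_le_1:
  assumes fr: "is_frame n m \<Phi>" and L: "\<Lambda> \<subseteq> {..<n}" and f: "f \<in> carrier_vec m" "f \<noteq> 0\<^sub>v m"
    and ev: "error_op m \<Phi> (canonical_dual n m \<Phi>) \<Lambda> f = \<mu> \<cdot>\<^sub>v f"
  shows "cmod \<mu> \<le> 1"
proof -
  let ?s = "\<lambda>\<Lambda>. \<Sum>i\<in>\<Lambda>. (cmod (f \<bullet>c \<Phi> i))\<^sup>2"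
  have car: "\<And>i. i < n \<Longrightarrow> \<Phi> i \<in> carrier_vec m"
    using fr by (auto simp: is_frame_def)
  have Sf: "frame_op n m \<Phi> f \<in> carrier_vec m"
    using car by (intro frame_op_carrier) auto
  have "f \<bullet>c frame_op n m \<Phi> f = (\<Sum>i<n. (f \<bullet>c \<Phi> i) * (\<Phi> i \<bullet>c f))"
    unfolding frame_op_self_adjoint[OF fr f(1) f(1)]
    unfolding frame_op_eq_error_op
    by (rule error_op_cscalar_prod) (use car f in auto)
  also have "\<dots> = (\<Sum>i<n. (f \<bullet>c \<Phi> i) * cnj (f \<bullet>c \<Phi> i))"
    using car f by (intro sum.cong) (auto simp: cscalar_prod_commute[of f m])
  also have "\<dots> = of_real (?s {..<n})"
    by (simp only: of_real_sum complex_norm_square)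
  finally have full: "f \<bullet>c frame_op n m \<Phi> f = of_real (?s {..<n})" .
  have "of_real (?s \<Lambda>) = \<mu> * of_real (?s {..<n})"
    using error_op_canonical_dual_cscalar_prod_frame_op[OF fr L f(1)] f Sf
    by (simp add: ev full del: of_real_sum)
  \<comment> \<open>Both sums are nonnegative reals, so taking moduli changes only \<mu>.\<close>
  then have "cmod (of_real (?s \<Lambda>)) = cmod \<mu> * cmod (of_real (?s {..<n}))"
    by (simp only: norm_mult)
  then have "?s \<Lambda> = cmod \<mu> * ?s {..<n}"
    by (simp only: norm_of_real abs_of_nonneg sum_nonneg zero_le_power2)
  moreover have "?s \<Lambda> \<le> ?s {..<n}"
    using L by (intro sum_mono2) auto
  moreover have "0 < ?s {..<n}"
    by (rule frame_coefficients_pos[OF fr f])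
  ultimately show ?thesis
    by (simp add: mult_le_cancel_right1)
qed

lemma spectral_radius_eqI:
  assumes A: "A \<in> carrier_mat m m" and "v \<in> carrier_vec m" "v \<noteq> 0\<^sub>v m" "A *\<^sub>v v = \<mu> \<cdot>\<^sub>v v"
    and bound: "\<And>w \<nu>. w \<in> carrier_vec m \<Longrightarrow> w \<noteq> 0\<^sub>v m \<Longrightarrow> A *\<^sub>v w = \<nu> \<cdot>\<^sub>v w \<Longrightarrow> cmod \<nu> \<le> cmod \<mu>"
  shows "spectral_radius A = cmod \<mu>"
  unfolding spectral_radius_def
proof (rule Max_eqI)
  show "finite (cmod ` spectrum A)"
    using card_finite_spectrum(1)[OF A] by simp
  have "\<mu> \<in> spectrum A"
    using assms by (auto simp: spectrum_def eigenvalue_def eigenvector_def)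
  then show "cmod \<mu> \<in> cmod ` spectrum A"
    by (rule imageI)
  show "\<And>y. y \<in> cmod ` spectrum A \<Longrightarrow> y \<le> cmod \<mu>"
    using A bound by (auto simp: spectrum_def eigenvalue_def eigenvector_def)
qed

section \<open>Kernel of the Laplacian and linear relations among the frame vectors\<close>

text \<open>The absence of parallel arcs makes \<open>head G\<close> injective on the arcs leaving
  \<open>v\<close>, so arcs and neighbours are equally many.\<close>

lemma (in graph) sum_dominates_eq_out_degree:
  "(\<Sum>w\<in>verts G. if v \<rightarrow>\<^bsub>G\<^esub> w then 1 else 0) = of_nat (out_degree G v)"
proof -
  have "(\<Sum>w\<in>verts G. if v \<rightarrow>\<^bsub>G\<^esub> w then 1 else 0) = of_nat (card {w \<in> verts G. v \<rightarrow>\<^bsub>G\<^esub> w})"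
    by (simp add: sum.If_cases Int_def)
  also have "{w \<in> verts G. v \<rightarrow>\<^bsub>G\<^esub> w} = head G ` out_arcs G v"
    by (auto simp: out_arcs_def arcs_ends_def arc_to_ends_def)
  also have "card \<dots> = out_degree G v"
    unfolding out_degree_def
    by (rule card_image) (auto simp: inj_on_def arc_to_ends_def intro: no_multi_arcs)
  finally show ?thesis .
qed

text \<open>This puts the all-ones vector in the kernel of the Laplacian: the degree on the diagonal
  cancels the number of neighbours.\<close>

lemma laplacian_row_sum:
  assumes "graph G" "distinct vs" "set vs = verts G" "i < length vs"
  shows "(\<Sum>j<length vs. laplacian_mat G vs $$ (i, j)) = 0"
proof -
  interpret graph G by fact
  have "(\<Sum>j<length vs. laplacian_mat G vs $$ (i, j))
      = (\<Sum>j<length vs. if i = j then of_nat (out_degree G (vs ! i)) else 0)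
        - (\<Sum>j<length vs. if (vs ! i) \<rightarrow>\<^bsub>G\<^esub> (vs ! j) then 1 else 0)"
    using assms(4) unfolding sum_subtractf[symmetric]
    by (intro sum.cong) (auto simp: laplacian_mat_def degree_mat_def adjacency_mat_def mat_diag_def)
  also have "(\<Sum>j<length vs. if (vs ! i) \<rightarrow>\<^bsub>G\<^esub> (vs ! j) then 1 else 0)
      = (\<Sum>w\<in>verts G. if (vs ! i) \<rightarrow>\<^bsub>G\<^esub> w then 1 else (0 :: complex))"
    by (rule sum.reindex_bij_betw) (use bij_betw_nth[OF assms(2) refl] assms(3) in auto)
  finally show ?thesis
    using assms(4) by (simp add: sum_dominates_eq_out_degree)
qed

lemma index_mat_adjoint:
  assumes "i < dim_col M" "j < dim_row M"
  shows "mat_adjoint M $$ (i, j) = cnj (M $$ (j, i))"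
  using assms by (auto simp: mat_adjoint_def mat_of_rows_def)

lemma mat_adjoint_carrier:
  assumes "M \<in> carrier_mat a b"
  shows "mat_adjoint M \<in> carrier_mat b a"
  using assms by (auto simp: mat_adjoint_def)

text \<open>Up to nonzero factors, pairing \<open>c\<close> with coordinate \<open>k\<close> of the
  frame gives coordinate \<open>k\<close> of M* c. A relation therefore kills all these coordinates
  but the last and makes \<open>c\<close> a multiple of the last column of M. The all-ones vector is
  such a multiple too, so that column is constant.\<close>

lemma
  assumes LG: "is_LG_frame G n (n - 1) \<Phi>" and k: "k < n - 1"
  shows LG_frame_sum_eq_0: "(\<Sum>i<n. \<Phi> i $ k) = 0"
    and LG_frame_relation_const: "(\<And>k. k < n - 1 \<Longrightarrow> (\<Sum>i<n. c i * \<Phi> i $ k) = 0) \<Longrightarrow>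
      p < n \<Longrightarrow> q < n \<Longrightarrow> c p = c q"
proof -
  define m where "m = n - 1"
  \<comment> \<open>The bound on \<open>k\<close> rules out \<open>n = 0\<close>, where the
    subtraction would be truncated.\<close>
  have n: "n = Suc m" using k by (simp add: m_def)
  obtain vs M and l :: "nat \<Rightarrow> real" where G: "graph G" and vs: "distinct vs" "set vs = verts G"
    and card: "card (verts G) = n"
    and M: "unitary_mat n M"
    and l: "\<And>i. i < m \<Longrightarrow> l i \<noteq> 0"
    and lap: "laplacian_mat G vs =
          M * mat_diag n (\<lambda>i. if i < m then of_real (l i) else 0) * mat_adjoint M"
    and \<Phi>: "\<And>i. i < n \<Longrightarrow> \<Phi> i =
      (mat_diag m (\<lambda>k. of_real (sqrt (l k))) * mat_adjoint (first_cols n m M)) *\<^sub>v unit_vec n i"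
    using LG unfolding is_LG_frame_def m_def by force
  have len: "length vs = n" using vs card distinct_card by force
  have Mc: "M \<in> carrier_mat n n" and MM: "mat_adjoint M * M = 1\<^sub>m n" "M * mat_adjoint M = 1\<^sub>m n"
    using M by (auto simp: unitary_mat_def)
  have Ac: "mat_adjoint M \<in> carrier_mat n n" by (rule mat_adjoint_carrier[OF Mc])
  have adj: "mat_adjoint (first_cols n m M) = mat m n (\<lambda>(k, i). cnj (M $$ (i, k)))"
    by (rule eq_matI) (auto simp: mat_adjoint_def first_cols_def mat_of_rows_def)
  have \<Phi>': "\<Phi> i $ k = of_real (sqrt (l k)) * cnj (M $$ (i, k))" if "i < n" "k < m" for i k
    unfolding \<Phi>[OF that(1)] adj using that by (subst mat_diag_mult_left[where nr = n]) auto
  \<comment> \<open>\<open>?w c k\<close> is coordinate \<open>k\<close> of M* c, that is, of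
    \<open>c\<close> in the orthonormal basis of columns of M.\<close>
  let ?w = "\<lambda>c k. \<Sum>i<n. cnj (M $$ (i, k)) * c i"
  have relation_iff: "(\<Sum>i<n. c i * \<Phi> i $ k) = 0 \<longleftrightarrow> ?w c k = 0" if "k < m" for c k
  proof -
    have "(\<Sum>i<n. c i * \<Phi> i $ k) = of_real (sqrt (l k)) * ?w c k"
      using that by (simp add: \<Phi>' sum_distrib_left mult_ac)
    \<comment> \<open>The real \<open>sqrt\<close> vanishes only at 0, since it is odd on negative
      arguments; \<open>l k \<noteq> 0\<close> is enough to cancel it.\<close>
    then show ?thesis using l[OF that] by simp
  qed
  \<comment> \<open>This is c = M (M* c), from the rows of M being orthonormal.\<close>
  have expand: "c p = (\<Sum>k<n. M $$ (p, k) * ?w c k)" if "p < n" for c p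
  proof -
    have row: "(\<Sum>k<n. M $$ (p, k) * cnj (M $$ (i, k))) = (if p = i then 1 else 0)" if "i < n" for i
    proof -
      have "(\<Sum>k<n. M $$ (p, k) * cnj (M $$ (i, k))) = (M * mat_adjoint M) $$ (p, i)"
        using that \<open>p < n\<close> Mc Ac
        by (auto simp: scalar_prod_def index_mat_adjoint lessThan_atLeast0 intro!: sum.cong)
      then show ?thesis using that \<open>p < n\<close> by (simp add: MM)
    qed
    have "(\<Sum>k<n. M $$ (p, k) * ?w c k) = (\<Sum>i<n. \<Sum>k<n. M $$ (p, k) * cnj (M $$ (i, k)) * c i)"
      by (subst sum.swap) (simp add: sum_distrib_left mult_ac)
    also have "\<dots> = (\<Sum>i<n. (if p = i then 1 else 0) * c i)"
      by (simp add: row flip: sum_distrib_right)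
    also have "\<dots> = c p"
      using that by (simp add: if_distrib[of "\<lambda>x. x * _"] cong: if_cong)
    finally show ?thesis by simp
  qed
  \<comment> \<open>Multiplying L = M D M* by M* gives M* L = D M*. Applied to the all-ones vector,
    row \<open>k\<close> reads \<open>l k * ?w (\<lambda>_. 1) k = 0\<close>.\<close>
  have ones: "?w (\<lambda>_. 1) k = 0" if k: "k < m" for k
  proof -
    let ?D = "mat_diag n (\<lambda>i. if i < m then of_real (l i) else 0) :: complex mat"
    let ?o = "vec n (\<lambda>_. 1) :: complex vec"
    have "laplacian_mat G vs *\<^sub>v ?o = 0\<^sub>v n"
    proof (rule eq_vecI)
      fix i assume i: "i < dim_vec (0\<^sub>v n :: complex vec)"
      have "(laplacian_mat G vs *\<^sub>v ?o) $ i = (\<Sum>j<length vs. laplacian_mat G vs $$ (i, j))"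
        using i len
        by (auto simp: scalar_prod_def lessThan_atLeast0 laplacian_mat_def adjacency_mat_def
          degree_mat_def intro!: sum.cong)
      then show "(laplacian_mat G vs *\<^sub>v ?o) $ i = 0\<^sub>v n $ i"
        using i len laplacian_row_sum[OF G vs, of i] by simp
    qed (use len in \<open>simp add: laplacian_mat_def adjacency_mat_def\<close>)
    moreover have "mat_adjoint M * laplacian_mat G vs = ?D * mat_adjoint M"
    proof -
      have "mat_adjoint M * laplacian_mat G vs = mat_adjoint M * (M * (?D * mat_adjoint M))"
        unfolding lap using Mc Ac by (simp add: assoc_mult_mat[of M n n ?D n])
      also have "\<dots> = (mat_adjoint M * M) * (?D * mat_adjoint M)"
        using Mc Ac by (intro assoc_mult_mat[symmetric, of _ n n _ n _ n] mult_carrier_mat[of _ n n]) auto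
      also have "\<dots> = ?D * mat_adjoint M"
        unfolding MM using Ac by (intro left_mult_one_mat mult_carrier_mat[of _ n n]) auto
      finally show ?thesis .
    qed
    moreover have "laplacian_mat G vs \<in> carrier_mat n n"
      using len by (auto simp: laplacian_mat_def adjacency_mat_def)
    moreover have "mat_adjoint M *\<^sub>v 0\<^sub>v n = 0\<^sub>v n"
      using Ac by (intro eq_vecI) auto
    ultimately have "(?D * mat_adjoint M) *\<^sub>v ?o = 0\<^sub>v n"
      using Ac assoc_mult_mat_vec[of "mat_adjoint M" n n "laplacian_mat G vs" n ?o] by simp
    moreover have "k < n" using k n by simp
    ultimately have "((?D * mat_adjoint M) *\<^sub>v ?o) $ k = 0" by simp
    moreover have "((?D * mat_adjoint M) *\<^sub>v ?o) $ k = of_real (l k) * ?w (\<lambda>_. 1) k"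
      using k \<open>k < n\<close> Mc Ac
      by (subst mat_diag_mult_left[OF Ac])
        (auto simp: scalar_prod_def index_mat_adjoint lessThan_atLeast0 sum_distrib_left intro!: sum.cong)
    ultimately show ?thesis using l[OF k] by simp
  qed
  show "(\<Sum>i<n. \<Phi> i $ k) = 0"
    using relation_iff[of k "\<lambda>_. 1"] ones k by (simp add: m_def)
  show "c p = c q" if c: "\<And>k. k < n - 1 \<Longrightarrow> (\<Sum>i<n. c i * \<Phi> i $ k) = 0" and pq: "p < n" "q < n"
  proof -
    \<comment> \<open>With \<open>n = Suc m\<close>, only the index \<open>m\<close> survives in the
      expansion.\<close>
    have last: "d p = M $$ (p, m) * ?w d m" if "\<And>k. k < m \<Longrightarrow> ?w d k = 0" "p < n" for d p
      using expand[OF that(2), of d] that(1) by (simp add: n)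
    have c': "c p = M $$ (p, m) * ?w c m" if "p < n" for p
      by (rule last) (use c relation_iff that in \<open>auto simp: m_def\<close>)
    have one: "M $$ (p, m) * ?w (\<lambda>_. 1) m = 1" if "p < n" for p
      by (rule last[of "\<lambda>_. 1", symmetric]) (use ones that in auto)
    \<comment> \<open>The product in \<open>one\<close> equals 1, so this factor can be cancelled to
      compare two entries of the last column.\<close>
    have "?w (\<lambda>_. 1) m \<noteq> 0"
      using one[OF pq(1)] by force
    moreover have "M $$ (p, m) * ?w (\<lambda>_. 1) m = M $$ (q, m) * ?w (\<lambda>_. 1) m"
      by (simp only: one pq)
    ultimately have eq: "M $$ (p, m) = M $$ (q, m)"
      by (simp only: mult_cancel_right simp_thms)
    have "c p = M $$ (p, m) * ?w c m"
      by (rule c'[OF pq(1)])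
    also have "\<dots> = M $$ (q, m) * ?w c m"
      by (simp only: eq)
    also have "\<dots> = c q"
      by (rule c'[OF pq(2), symmetric])
    finally show ?thesis .
  qed
qed

section \<open>Differences of dual vectors and attainment of the bound\<close>

lemma LG_frame_dual_differences:
  assumes LG: "is_LG_frame G n (n - 1) \<Phi>" and n: "1 < n" and ij: "i < n" "j < n" and p: "p < n"
  shows "(canonical_dual n (n - 1) \<Phi> i - canonical_dual n (n - 1) \<Phi> j) \<bullet>c \<Phi> p
    = of_bool (p = i) - of_bool (p = j)"
proof -
  define m where "m = n - 1"
  have fr: "is_frame n m \<Phi>" using is_LG_frame_imp_is_frame[OF LG] by (simp add: m_def)
  have car: "\<And>i. i < n \<Longrightarrow> \<Phi> i \<in> carrier_vec m"
    using fr by (auto simp: is_frame_def)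
  let ?\<psi> = "canonical_dual n m \<Phi>"
  have \<psi>: "\<And>i. i < n \<Longrightarrow> ?\<psi> i \<in> carrier_vec m"
    by (rule canonical_dual_carrier[OF fr])
  let ?f = "?\<psi> i - ?\<psi> j"
  \<comment> \<open>The error between actual and claimed coefficients. It is a linear relation,
    hence constant, and its total is 0, hence it vanishes.\<close>
  define c where "c p = (?f \<bullet>c \<Phi> p) - (of_bool (p = i) - of_bool (p = j))" for p
  have diff: "?f \<bullet>c \<Phi> p = (?\<psi> i \<bullet>c \<Phi> p) - (?\<psi> j \<bullet>c \<Phi> p)" if "p < n" for p
    using \<psi> ij car that by (simp add: minus_scalar_prod_distrib[of _ m])
  have expand: "(\<Sum>p<n. (?\<psi> i \<bullet>c \<Phi> p) * \<Phi> p $ k) = \<Phi> i $ k" if "i < n" "k < m" for i k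
    using index_frame_op[of n \<Phi> m k "?\<psi> i"] frame_op_canonical_dual[OF fr that(1)] car that by simp
  have delta: "(\<Sum>p<n. of_bool (p = i) * g p) = g i" if "i < n" for i and g :: "nat \<Rightarrow> complex"
    using that by (simp add: of_bool_def if_distrib[of "\<lambda>x. x * _"] cong: if_cong)
  \<comment> \<open>Both coefficient families synthesize \<Phi> i - \<Phi> j: the actual ones
    because S maps the dual vectors to \<Phi> i and \<Phi> j, the claimed ones trivially.\<close>
  have "(\<Sum>p<n. c p * \<Phi> p $ k) = 0" if "k < m" for k
  proof -
    have "(\<Sum>p<n. c p * \<Phi> p $ k) = (\<Sum>p<n. (?\<psi> i \<bullet>c \<Phi> p) * \<Phi> p $ k) - (\<Sum>p<n. (?\<psi> j \<bullet>c \<Phi> p) * \<Phi> p $ k)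
       - ((\<Sum>p<n. of_bool (p = i) * \<Phi> p $ k) - (\<Sum>p<n. of_bool (p = j) * \<Phi> p $ k))"
      unfolding sum_subtractf[symmetric] by (intro sum.cong) (auto simp: c_def diff algebra_simps)
    then show ?thesis using that ij by (simp add: expand delta)
  qed
  \<comment> \<open>The instance \<open>0\<close> is a coordinate below \<open>n - 1\<close>,
    available because \<open>1 < n\<close>.\<close>
  then have const: "c q = c p" if "q < n" for q
    using LG_frame_relation_const[OF LG _ _ that p, of 0 c] n by (simp add: m_def)
  \<comment> \<open>The coefficients of any vector sum to its product with the sum of all frame
    vectors, which is zero.\<close>
  have "(\<Sum>p<n. ?f \<bullet>c \<Phi> p) = (\<Sum>k<m. ?f $ k * cnj (\<Sum>p<n. \<Phi> p $ k))"
    using car by (simp add: cscalar_prod_sum[of _ m] sum_distrib_left) (rule sum.swap)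
  also have "\<dots> = 0"
    using LG_frame_sum_eq_0[OF LG] by (simp add: m_def)
  finally have "(\<Sum>p<n. c p) = 0"
    using delta[of i "\<lambda>_. 1"] delta[of j "\<lambda>_. 1"] ij by (simp add: c_def sum_subtractf)
  moreover have "(\<Sum>p<n. c p) = of_nat n * c p"
    using const by simp
  ultimately have "c p = 0" using n by simp
  then show ?thesis by (simp add: c_def m_def)
qed

lemma LG_frame_spectral_radius_error_op:
  assumes LG: "is_LG_frame G n (n - 1) \<Phi>" and L: "\<Lambda> \<subseteq> {..<n}" "2 \<le> card \<Lambda>"
  shows "spectral_radius (operator_mat (n - 1)
    (error_op (n - 1) \<Phi> (canonical_dual n (n - 1) \<Phi>) \<Lambda>)) = 1"
proof -
  define m where "m = n - 1"
  have fr: "is_frame n m \<Phi>" using is_LG_frame_imp_is_frame[OF LG] by (simp add: m_def)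
  have fin: "finite \<Lambda>" using L(1) finite_subset by blast
  obtain i j where ij: "i \<in> \<Lambda>" "j \<in> \<Lambda>" "i \<noteq> j"
    using L(2) by (metis card_le_Suc0_iff_eq fin not_less_eq_eq numeral_2_eq_2)
  then have "i < n" "j < n" using L(1) by auto
  with ij(3) have ijn: "i < n" "j < n" "1 < n" by auto
  let ?\<psi> = "canonical_dual n m \<Phi>"
  let ?f = "?\<psi> i - ?\<psi> j"
  let ?E = "error_op m \<Phi> ?\<psi> \<Lambda>"
  have car: "\<And>i. i \<in> \<Lambda> \<Longrightarrow> \<Phi> i \<in> carrier_vec m"
    using fr L(1) by (auto simp: is_frame_def)
  have \<psi>: "\<And>i. i \<in> \<Lambda> \<Longrightarrow> ?\<psi> i \<in> carrier_vec m"
    using L(1) by (intro canonical_dual_carrier[OF fr]) auto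
  have f: "?f \<in> carrier_vec m" using \<psi> ij by simp
  have coeff: "?f \<bullet>c \<Phi> p = of_bool (p = i) - of_bool (p = j)" if "p < n" for p
    using LG_frame_dual_differences[OF LG ijn(3,1,2) that] by (simp add: m_def)
  \<comment> \<open>Here \<open>i \<noteq> j\<close> enters: a nonzero coefficient forces
    \<open>?f\<close> to be nonzero.\<close>
  have "?f \<bullet>c \<Phi> i = 1" using coeff[OF ijn(1)] ij by simp
  then have f0: "?f \<noteq> 0\<^sub>v m"
    using car[OF ij(1)] by (auto simp: cscalar_prod_sum[of _ m])
  have mult: "operator_mat m ?E *\<^sub>v g = ?E g" if "g \<in> carrier_vec m" for g
    by (rule operator_mat_error_op_mult_vec[OF fin car \<psi> that])
  have "?E ?f = ?f"
  proof (rule eq_vecI)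
    show "dim_vec (?E ?f) = dim_vec ?f"
      using carrier_vecD[OF error_op_carrier[of \<Lambda> ?\<psi> m, OF \<psi>]] carrier_vecD[OF f] by simp
    fix k assume "k < dim_vec ?f"
    then have k: "k < m" unfolding carrier_vecD[OF f] .
    \<comment> \<open>Only the terms at \<open>i\<close> and \<open>j\<close> remain, and both
      indices lie in \<Lambda>, so they rebuild \<open>?f\<close>.\<close>
    have "?E ?f $ k = (\<Sum>p\<in>\<Lambda>. (of_bool (p = i) - of_bool (p = j)) * ?\<psi> p $ k)"
      using fin \<psi> k coeff L(1) by (auto simp: index_error_op intro!: sum.cong)
    also have "\<dots> = (\<Sum>p\<in>\<Lambda>. if p = i then ?\<psi> p $ k else 0) - (\<Sum>p\<in>\<Lambda>. if p = j then ?\<psi> p $ k else 0)"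
      unfolding sum_subtractf[symmetric] by (intro sum.cong) auto
    also have "\<dots> = ?f $ k"
      using fin ij k carrier_vecD[OF \<psi>[OF ij(2)]] by simp
    finally show "?E ?f $ k = ?f $ k" .
  qed
  then have "spectral_radius (operator_mat m ?E) = cmod 1"
  proof (intro spectral_radius_eqI[OF _ f f0])
    fix w \<nu> assume w: "w \<in> carrier_vec m" "w \<noteq> 0\<^sub>v m" "operator_mat m ?E *\<^sub>v w = \<nu> \<cdot>\<^sub>v w"
    show "cmod \<nu> \<le> cmod 1"
      using eigenvalue_error_op_canonical_dual_le_1[OF fr L(1) w(1,2)] w(3) mult[OF w(1)] by simp
  qed (use mult[OF f] in \<open>auto simp: operator_mat_def\<close>)
  then show ?thesis by (simp add: m_def)
qed

theorem theorem3p2: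
  fixes G :: "('a, 'b) pre_digraph" and n :: nat and \<Phi> :: "nat \<Rightarrow> complex vec"
  assumes "graph G" and "Digraph_Component.connected G" and "card (verts G) = n"
    and "is_LG_frame G n (n - 1) \<Phi>"
  shows "\<forall>r \<in> {1..n - 1} - {1}.
    max_error_radius n (n - 1) \<Phi> (canonical_dual n (n - 1) \<Phi>) r = 1"
proof
  fix r assume "r \<in> {1..n - 1} - {1}"
  then have r: "2 \<le> r" "r \<le> n" by auto
  let ?\<rho> = "\<lambda>\<Lambda>. spectral_radius (operator_mat (n - 1)
    (error_op (n - 1) \<Phi> (canonical_dual n (n - 1) \<Phi>) \<Lambda>))"
  let ?F = "{\<Lambda>. \<Lambda> \<subseteq> {..<n} \<and> card \<Lambda> = r}"
  \<comment> \<open>A witness that index sets of size \<open>r\<close> exist; without one the set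
    under \<open>Max\<close> would be empty rather than \<open>{1}\<close>.\<close>
  have "{..<r} \<in> ?F"
    using r by auto
  then have "?F \<noteq> {}"
    by blast
  moreover have "?\<rho> \<Lambda> = 1" if "\<Lambda> \<in> ?F" for \<Lambda>
    using LG_frame_spectral_radius_error_op[OF assms(4), of \<Lambda>] r that by simp
  ultimately have "?\<rho> ` ?F = {1}"
    by (simp add: image_constant_conv cong: image_cong_simp)
  then have "{?\<rho> \<Lambda> | \<Lambda>. \<Lambda> \<subseteq> {..<n} \<and> card \<Lambda> = r} = {1}"
    unfolding image_Collect .
  then show "max_error_radius n (n - 1) \<Phi> (canonical_dual n (n - 1) \<Phi>) r = 1"
    by (simp add: max_error_radius_def)
qed

end
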